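(* There exists an $O(nd)$ time reduction from $\mathsf{2D\;LWS}_n$ with rank $d$ and $w_1=w_2=w$ to $\mathsf{2D\;LWS}^{\mathsf{PT}}_{2n}$ with rank $d$: given vectors defining a rank-$d$ tensor $w:[n]^3\to\mathbb{Z}$, one can compute in $O(nd)$ time vectors defining a rank-$d$ tensor $w':[2n]^3\to\mathbb{Z}$ such that the answer of $\mathsf{2D\;LWS}^{\mathsf{PT}}$ on $w'$ equals the answer of $\mathsf{2D\;LWS}$ on $(w_1,w_2)=(w,w)$.
   Context: A tensor $w:[n]^3\to\mathbb{R}$ has rank $d$ if there are vectors $\mu_i,\sigma_j,\tau_k\in\mathbb{R}^d$ with $w[i,j,k]=\sum_{s=1}^d\mu_i[s]\sigma_j[s]\tau_k[s]$; such tensors are given as input by these vectors. $\mathsf{2D\;LWS}_n$: given $w_1,w_2:[n]^3\to\{-W,\ldots,W,\infty\}$, define $T[1,1]=0$ and otherwise $T[i,j]=\min\bigl(\min_{1\le k<i}(T[k,j]+w_1[i,j,k]),\ \min_{1\le k<j}(T[i,k]+w_2[i,j,k])\bigr)$; the answer is $T[n,n]$. $\mathsf{2D\;LWS}^{\mathsf{PT}}_m$: given $w:[m]^3\to\{-W,\ldots,W,\infty\}$, define $T[i,j]=0$ if $j-i\le 1$ and otherwise $T[i,j]=\min_{i<k<j}(T[i,k]+T[k,j]+w[i,j,k])$; the answer is $T[1,m]$. *)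

theory Defs
  imports "HOL-Library.Extended_Real"
begin

subsection \<open>Tensors given by vectors\<close>

text \<open>
  Tensors on \<open>[m]\<^sup>3\<close> are functions of which only the values at indices in \<open>{1..m}\<close> matter;
  likewise a family of \<open>m\<close> vectors of length \<open>d\<close> is a function \<open>v\<close> with entries \<open>v i s\<close> for
  \<open>i \<in> {1..m}\<close> and \<open>s \<in> {1..d}\<close>.
\<close>

definition defines_tensor ::
  "nat \<Rightarrow> nat \<Rightarrow> (nat \<Rightarrow> nat \<Rightarrow> real) \<Rightarrow> (nat \<Rightarrow> nat \<Rightarrow> real) \<Rightarrow> (nat \<Rightarrow> nat \<Rightarrow> real) \<Rightarrow>
   (nat \<Rightarrow> nat \<Rightarrow> nat \<Rightarrow> int) \<Rightarrow> bool"
where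
  "defines_tensor m d \<mu> \<sigma> \<tau> w \<longleftrightarrow>
     (\<forall>i\<in>{1..m}. \<forall>j\<in>{1..m}. \<forall>k\<in>{1..m}.
        real_of_int (w i j k) = (\<Sum>s=1..d. \<mu> i s * \<sigma> j s * \<tau> k s))"

subsection \<open>The two dynamic programs\<close>

text \<open>
  Values lie in \<open>ereal\<close> so that weights may be \<open>\<infinity>\<close>; the minimum over an empty range is \<open>\<infinity>\<close>.
  All other minima are over finite nonempty ranges, so \<open>INF\<close> is attained.
\<close>

function lws2_table ::
  "(nat \<Rightarrow> nat \<Rightarrow> nat \<Rightarrow> ereal) \<Rightarrow> (nat \<Rightarrow> nat \<Rightarrow> nat \<Rightarrow> ereal) \<Rightarrow> nat \<Rightarrow> nat \<Rightarrow> ereal"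
where
  "lws2_table w1 w2 i j =
     (if i = 1 \<and> j = 1 then 0
      else min (INF k\<in>{1..<i}. lws2_table w1 w2 k j + w1 i j k)
               (INF k\<in>{1..<j}. lws2_table w1 w2 i k + w2 i j k))"
  by pat_completeness auto
termination by (relation "measure (\<lambda>(w1, w2, i, j). i + j)") auto

definition lws2 ::
  "nat \<Rightarrow> (nat \<Rightarrow> nat \<Rightarrow> nat \<Rightarrow> ereal) \<Rightarrow> (nat \<Rightarrow> nat \<Rightarrow> nat \<Rightarrow> ereal) \<Rightarrow> ereal"
where
  "lws2 n w1 w2 = lws2_table w1 w2 n n"

function lws2_pt_table :: "(nat \<Rightarrow> nat \<Rightarrow> nat \<Rightarrow> ereal) \<Rightarrow> nat \<Rightarrow> nat \<Rightarrow> ereal"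
where
  "lws2_pt_table w i j =
     (if j \<le> i + 1 then 0
      else (INF k\<in>{i<..<j}. lws2_pt_table w i k + lws2_pt_table w k j + w i j k))"
  by pat_completeness auto
termination by (relation "measure (\<lambda>(w, i, j). j - i)") auto

definition lws2_pt :: "nat \<Rightarrow> (nat \<Rightarrow> nat \<Rightarrow> nat \<Rightarrow> ereal) \<Rightarrow> ereal"
where
  "lws2_pt m w = lws2_pt_table w 1 m"

declare lws2_table.simps [simp del] lws2_pt_table.simps [simp del]

subsection \<open>Running time: programs for a unit-cost real RAM\<close>

text \<open>
  Registers and arrays come in two sorts, natural numbers (used for indexing) and reals, and are
  named by natural numbers. Arrays are accessed at the index held in a register; this is the
  only form of indirect addressing, so a program refers to a fixed finite set of registers and
  arrays. Every elementary instruction and every test costs one step. Natural numbers are not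
  multiplied, and reals cannot be converted to naturals (in particular there is no rounding), so
  a step never does more than constant-time work in the usual real RAM.
\<close>

record state =
  ireg :: "nat \<Rightarrow> nat"
  iarr :: "nat \<Rightarrow> nat \<Rightarrow> nat"
  rreg :: "nat \<Rightarrow> real"
  rarr :: "nat \<Rightarrow> nat \<Rightarrow> real"

text \<open>
  The first argument is the destination, except that \<open>IStore a i x\<close> and \<open>RStore a i x\<close> write
  register \<open>x\<close> to array \<open>a\<close> at the index held in register \<open>i\<close>.
\<close>

datatype instr =
    IConst nat nat
  | IAdd nat nat nat
  | ISub nat nat nat
  | ILoad nat nat nat
  | IStore nat nat nat
  | RConst nat int
  | RAdd nat nat nat
  | RSub nat nat nat
  | RMul nat nat nat
  | RDiv nat nat nat
  | RLoad nat nat nat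
  | RStore nat nat nat

fun exec_instr :: "instr \<Rightarrow> state \<Rightarrow> state" where
  "exec_instr (IConst x c) S = S\<lparr>ireg := (ireg S)(x := c)\<rparr>"
| "exec_instr (IAdd x y z) S = S\<lparr>ireg := (ireg S)(x := ireg S y + ireg S z)\<rparr>"
| "exec_instr (ISub x y z) S = S\<lparr>ireg := (ireg S)(x := ireg S y - ireg S z)\<rparr>"
| "exec_instr (ILoad x a i) S = S\<lparr>ireg := (ireg S)(x := iarr S a (ireg S i))\<rparr>"
| "exec_instr (IStore a i x) S =
     S\<lparr>iarr := (iarr S)(a := (iarr S a)(ireg S i := ireg S x))\<rparr>"
| "exec_instr (RConst x c) S = S\<lparr>rreg := (rreg S)(x := real_of_int c)\<rparr>"
| "exec_instr (RAdd x y z) S = S\<lparr>rreg := (rreg S)(x := rreg S y + rreg S z)\<rparr>"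
| "exec_instr (RSub x y z) S = S\<lparr>rreg := (rreg S)(x := rreg S y - rreg S z)\<rparr>"
| "exec_instr (RMul x y z) S = S\<lparr>rreg := (rreg S)(x := rreg S y * rreg S z)\<rparr>"
| "exec_instr (RDiv x y z) S = S\<lparr>rreg := (rreg S)(x := rreg S y / rreg S z)\<rparr>"
| "exec_instr (RLoad x a i) S = S\<lparr>rreg := (rreg S)(x := rarr S a (ireg S i))\<rparr>"
| "exec_instr (RStore a i x) S =
     S\<lparr>rarr := (rarr S)(a := (rarr S a)(ireg S i := rreg S x))\<rparr>"

datatype test = ILess nat nat | RLess nat nat

fun eval_test :: "test \<Rightarrow> state \<Rightarrow> bool" where
  "eval_test (ILess x y) S \<longleftrightarrow> ireg S x < ireg S y"
| "eval_test (RLess x y) S \<longleftrightarrow> rreg S x < rreg S y"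

datatype prog =
    Instr instr
  | Seq prog prog
  | Cond test prog prog
  | While test prog

text \<open>\<open>runs P S t S'\<close>: started in \<open>S\<close>, the program \<open>P\<close> halts in \<open>S'\<close> after exactly \<open>t\<close> steps.\<close>

inductive runs :: "prog \<Rightarrow> state \<Rightarrow> nat \<Rightarrow> state \<Rightarrow> bool" where
  Instr: "runs (Instr c) S 1 (exec_instr c S)"
| Seq: "runs P S t S' \<Longrightarrow> runs Q S' t' S'' \<Longrightarrow> runs (Seq P Q) S (t + t') S''"
| CondTrue: "eval_test b S \<Longrightarrow> runs P S t S' \<Longrightarrow> runs (Cond b P Q) S (t + 1) S'"
| CondFalse: "\<not> eval_test b S \<Longrightarrow> runs Q S t S' \<Longrightarrow> runs (Cond b P Q) S (t + 1) S'"
| WhileFalse: "\<not> eval_test b S \<Longrightarrow> runs (While b P) S 1 S"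
| WhileTrue: "eval_test b S \<Longrightarrow> runs P S t S' \<Longrightarrow> runs (While b P) S' t' S'' \<Longrightarrow>
    runs (While b P) S (t + t' + 1) S''"

lemma runs_deterministic:
  "runs P S t S' \<Longrightarrow> runs P S u U \<Longrightarrow> u = t \<and> U = S'"
proof (induction arbitrary: u U rule: runs.induct)
  case (Instr c S)
  then show ?case by (auto elim: runs.cases)
next
  case (Seq P S t S' Q t' S'')
  from Seq.prems show ?case by cases (use Seq.IH in blast)
next
  case (CondTrue b S P t S' Q)
  from CondTrue.prems show ?case by cases (use CondTrue.IH CondTrue.hyps in blast)+
next
  case (CondFalse b S Q t S' P)
  from CondFalse.prems show ?case by cases (use CondFalse.IH CondFalse.hyps in blast)+
next
  case (WhileFalse b S P)
  from WhileFalse.prems show ?case by cases (use WhileFalse.hyps in auto)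
next
  case (WhileTrue b S P t S' t' S'')
  from WhileTrue.prems show ?case by cases (use WhileTrue.IH WhileTrue.hyps in blast)+
qed

text \<open>
  A family of \<open>m\<close> vectors of length \<open>d\<close> is stored in row-major order from cell \<open>0\<close> on. An instance
  consists of \<open>m\<close> and \<open>d\<close> in registers \<open>0\<close> and \<open>1\<close> and three families in the consecutive arrays
  \<open>a\<close>, \<open>a + 1\<close>, \<open>a + 2\<close>. The remaining memory is unconstrained.
\<close>

definition stores_vectors :: "nat \<Rightarrow> nat \<Rightarrow> nat \<Rightarrow> (nat \<Rightarrow> nat \<Rightarrow> real) \<Rightarrow> state \<Rightarrow> bool"
where
  "stores_vectors a m d v S \<longleftrightarrow>
     (\<forall>i\<in>{1..m}. \<forall>s\<in>{1..d}. rarr S a ((i - 1) * d + (s - 1)) = v i s)"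

definition stores_instance ::
  "nat \<Rightarrow> nat \<Rightarrow> nat \<Rightarrow> (nat \<Rightarrow> nat \<Rightarrow> real) \<Rightarrow> (nat \<Rightarrow> nat \<Rightarrow> real) \<Rightarrow> (nat \<Rightarrow> nat \<Rightarrow> real) \<Rightarrow>
   state \<Rightarrow> bool"
where
  "stores_instance a m d \<mu> \<sigma> \<tau> S \<longleftrightarrow>
     ireg S 0 = m \<and> ireg S 1 = d \<and>
     stores_vectors a m d \<mu> S \<and>
     stores_vectors (a + 1) m d \<sigma> S \<and>
     stores_vectors (a + 2) m d \<tau> S"

end

theory Submission imports Defs begin

text \<open>
  The cell \<open>(i, j)\<close> of the grid becomes the interval from \<open>n + 1 - i\<close> to \<open>n + j\<close> of \<open>[2n]\<close>.
  Splitting this interval at a point of the left half leaves a piece inside the left half and the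
  interval of a cell with smaller \<open>i\<close>; splitting it in the right half is the move in \<open>j\<close>. So the
  recurrences agree as soon as intervals inside one half cost \<open>0\<close>. This is achieved by mirroring
  the vectors at the middle of \<open>[2n]\<close>, with zero vectors in place of \<open>\<mu>\<close> in the right half and of
  \<open>\<sigma>\<close> in the left half; the rank does not change.
\<close>

subsection \<open>The reduction\<close>

definition left_vectors :: "nat \<Rightarrow> (nat \<Rightarrow> nat \<Rightarrow> real) \<Rightarrow> nat \<Rightarrow> nat \<Rightarrow> real" where
  "left_vectors n \<mu> i s = (if i \<le> n then \<mu> (n + 1 - i) s else 0)"

definition right_vectors :: "nat \<Rightarrow> (nat \<Rightarrow> nat \<Rightarrow> real) \<Rightarrow> nat \<Rightarrow> nat \<Rightarrow> real" where
  "right_vectors n \<sigma> j s = (if j \<le> n then 0 else \<sigma> (j - n) s)"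

text \<open>Distance from the middle of \<open>[2n]\<close>: both \<open>n + 1 - i\<close> and
  \<open>n + i\<close> go to \<open>i\<close>.\<close>

definition mirror :: "nat \<Rightarrow> nat \<Rightarrow> nat" where
  "mirror n k = (if k \<le> n then n + 1 - k else k - n)"

definition fold_tensor :: "nat \<Rightarrow> (nat \<Rightarrow> nat \<Rightarrow> nat \<Rightarrow> int) \<Rightarrow> nat \<Rightarrow> nat \<Rightarrow> nat \<Rightarrow> int" where
  "fold_tensor n w i j k =
     (if i \<le> n \<and> n < j then w (mirror n i) (mirror n j) (mirror n k) else 0)"

text \<open>Unless \<open>i \<le> n < j\<close>, a factor from the first two families vanishes in
  every summand; otherwise the sum is that of \<open>w\<close> at the mirrored indices. The third
  family is mirrored in both halves, as a split point may lie in either.\<close>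

lemma defines_tensor_fold:
  assumes "defines_tensor n d \<mu> \<sigma> \<tau> w"
  shows "defines_tensor (2 * n) d (left_vectors n \<mu>) (right_vectors n \<sigma>)
    (\<lambda>k. \<tau> (mirror n k)) (fold_tensor n w)"
  unfolding defines_tensor_def
proof (intro ballI)
  fix i j k assume ijk: "i \<in> {1..2 * n}" "j \<in> {1..2 * n}" "k \<in> {1..2 * n}"
  show "real_of_int (fold_tensor n w i j k) =
    (\<Sum>s = 1..d. left_vectors n \<mu> i s * right_vectors n \<sigma> j s * \<tau> (mirror n k) s)"
  proof (cases "i \<le> n \<and> n < j")
    case True
    have "mirror n i \<in> {1..n}" "mirror n j \<in> {1..n}" "mirror n k \<in> {1..n}"
      using ijk by (auto simp: mirror_def)
    then show ?thesis
      using assms True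
      by (auto simp: defines_tensor_def fold_tensor_def left_vectors_def right_vectors_def
          mirror_def)
  next
    case False
    then show ?thesis
      by (auto simp: fold_tensor_def left_vectors_def right_vectors_def)
  qed
qed

section \<open>Agreement of the two recurrences\<close>

lemma lws2_pt_table_zero:
  assumes "\<And>i' j' k. i \<le> i' \<Longrightarrow> j' \<le> j \<Longrightarrow> w i' j' k = 0"
  shows "lws2_pt_table w i j = 0"
  using assms
proof (induction "j - i" arbitrary: i j rule: less_induct)
  case less
  show ?case
  proof (cases "j \<le> i + 1")
    case False
    have "lws2_pt_table w i k = 0" "lws2_pt_table w k j = 0" if "k \<in> {i<..<j}" for k
      using that less.prems by (auto intro!: less.hyps)
    \<comment> \<open>An infimum over an empty range would be \<open>\<infinity>\<close> instead of
      \<open>0\<close>.\<close>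
    moreover have "Suc i \<in> {i<..<j}" using False by simp
    then have "{i<..<j} \<noteq> {}" by blast
    ultimately show ?thesis
      using False less.prems by (subst lws2_pt_table.simps) (auto intro!: INF_eq_const)
  qed (simp add: lws2_pt_table.simps)
qed

lemma lws2_pt_table_fold:
  fixes w :: "nat \<Rightarrow> nat \<Rightarrow> nat \<Rightarrow> int"
  assumes "i \<in> {1..n}" "j \<in> {1..n}"
  defines "u \<equiv> \<lambda>i j k. ereal (real_of_int (w i j k))"
  defines "v \<equiv> \<lambda>i j k. ereal (real_of_int (fold_tensor n w i j k))"
  shows "lws2_pt_table v (n + 1 - i) (n + j) = lws2_table u u i j"
  using assms(1,2)
proof (induction "i + j" arbitrary: i j rule: less_induct)
  case less
  note ij = less.prems
  show ?case
  proof (cases "i = 1 \<and> j = 1")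
    case True
    \<comment> \<open>The cell \<open>(1, 1)\<close> is the interval from \<open>n\<close> to
      \<open>n + 1\<close>, which has no split point.\<close>
    then show ?thesis by (simp add: lws2_table.simps lws2_pt_table.simps)
  next
    case False
    let ?f = "\<lambda>k. lws2_pt_table v (n + 1 - i) k + lws2_pt_table v k (n + j)
      + v (n + 1 - i) (n + j) k"
    have left: "?f (n + 1 - k) = lws2_table u u k j + u i j k" if k: "k \<in> {1..<i}" for k
    proof -
      \<comment> \<open>The right end is at most \<open>n\<close>, so all subintervals lie in the
        left half and have weight \<open>0\<close>.\<close>
      have "lws2_pt_table v (n + 1 - i) (n + 1 - k) = 0"
        using k by (intro lws2_pt_table_zero) (auto simp: v_def fold_tensor_def)
      moreover have "lws2_pt_table v (n + 1 - k) (n + j) = lws2_table u u k j"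
        using k ij by (intro less.hyps) auto
      moreover have "v (n + 1 - i) (n + j) (n + 1 - k) = u i j k"
        using k ij by (auto simp: v_def u_def fold_tensor_def mirror_def)
      ultimately show ?thesis by simp
    qed
    have right: "?f (n + k) = lws2_table u u i k + u i j k" if k: "k \<in> {1..<j}" for k
    proof -
      have "lws2_pt_table v (n + k) (n + j) = 0"
        using k by (intro lws2_pt_table_zero) (auto simp: v_def fold_tensor_def)
      moreover have "lws2_pt_table v (n + 1 - i) (n + k) = lws2_table u u i k"
        using k ij by (intro less.hyps) auto
      moreover have "v (n + 1 - i) (n + j) (n + k) = u i j k"
        using k ij by (auto simp: v_def u_def fold_tensor_def mirror_def)
      ultimately show ?thesis by simp
    qed
    \<comment> \<open>Split points up to \<open>n\<close> are the moves in \<open>i\<close>, the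
      others those in \<open>j\<close>. For \<open>i = 1\<close> or \<open>j = 1\<close> an image is
      empty; its infimum \<open>\<infinity>\<close> does not affect the minimum.\<close>
    have split: "{n + 1 - i<..<n + j} = (\<lambda>k. n + 1 - k) ` {1..<i} \<union> (\<lambda>k. n + k) ` {1..<j}"
    proof (intro equalityI subsetI)
      fix k assume k: "k \<in> {n + 1 - i<..<n + j}"
      show "k \<in> (\<lambda>k. n + 1 - k) ` {1..<i} \<union> (\<lambda>k. n + k) ` {1..<j}"
      proof (cases "k \<le> n")
        case True
        then show ?thesis using k by (intro UnI1 image_eqI[of _ _ "n + 1 - k"]) auto
      next
        case False
        then show ?thesis using k by (intro UnI2 image_eqI[of _ _ "k - n"]) auto
      qed
    qed (use ij in auto)
    have "lws2_pt_table v (n + 1 - i) (n + j) = (INF k\<in>{n + 1 - i<..<n + j}. ?f k)"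
      using False ij by (subst lws2_pt_table.simps) auto
    also have "\<dots> = min (INF k\<in>{1..<i}. ?f (n + 1 - k)) (INF k\<in>{1..<j}. ?f (n + k))"
      by (simp only: split INF_union image_image inf_min)
    also have "\<dots> = min (INF k\<in>{1..<i}. lws2_table u u k j + u i j k)
      (INF k\<in>{1..<j}. lws2_table u u i k + u i j k)"
      by (simp only: left right cong: INF_cong)
    also have "\<dots> = lws2_table u u i j"
      using False by (subst (3) lws2_table.simps) auto
    finally show ?thesis .
  qed
qed

lemma lws2_pt_fold:
  assumes "n \<ge> 1"
  shows "lws2_pt (2 * n) (\<lambda>i j k. ereal (real_of_int (fold_tensor n w i j k))) =
    lws2 n (\<lambda>i j k. ereal (real_of_int (w i j k))) (\<lambda>i j k. ereal (real_of_int (w i j k)))"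
  using lws2_pt_table_fold[of n n n w] assms
  by (simp add: lws2_pt_def lws2_def mult_2)

subsection \<open>Running programs\<close>

fun block :: "instr \<Rightarrow> instr list \<Rightarrow> prog" where
  "block c [] = Instr c"
| "block c (c' # cs) = Seq (Instr c) (block c' cs)"

lemma runs_block: "runs (block c cs) S (Suc (length cs)) (fold exec_instr (c # cs) S)"
proof (induction c cs arbitrary: S rule: block.induct)
  case (1 c)
  then show ?case using runs.Instr by simp
next
  case (2 c c' cs)
  from runs.Seq[OF runs.Instr this] show ?case by simp
qed

text \<open>A total-correctness triple with a bound on the number of steps.\<close>

definition runs_within :: "prog \<Rightarrow> state \<Rightarrow> nat \<Rightarrow> (state \<Rightarrow> bool) \<Rightarrow> bool" where
  "runs_within P S t Q \<longleftrightarrow> (\<exists>u S'. runs P S u S' \<and> u \<le> t \<and> Q S')"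

lemma runs_within_block:
  assumes "Q (fold exec_instr (c # cs) S)" "Suc (length cs) \<le> t"
  shows "runs_within (block c cs) S t Q"
  unfolding runs_within_def using runs_block assms by blast

lemma runs_within_Seq:
  assumes "runs_within P S t R" "\<And>S'. R S' \<Longrightarrow> runs_within P' S' t' Q"
  shows "runs_within (Seq P P') S (t + t') Q"
  using assms unfolding runs_within_def by (meson add_mono runs.Seq)

text \<open>\<open>I\<close> is indexed by the number of completed passes. Each remaining pass costs
  at most \<open>c\<close> steps and one test; the final \<open>1\<close> is the failing
  test.\<close>

lemma runs_within_While:
  assumes "k \<le> m" "I k S"
    and "\<And>k S. k < m \<Longrightarrow> I k S \<Longrightarrow> eval_test b S \<and> runs_within P S c (I (Suc k))"
    and "\<And>S. I m S \<Longrightarrow> \<not> eval_test b S"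
  shows "runs_within (While b P) S ((m - k) * Suc c + 1) (I m)"
  using assms(1,2)
proof (induction arbitrary: S rule: inc_induct)
  case base
  then show ?case
    using runs.WhileFalse[OF assms(4)] by (auto simp: runs_within_def)
next
  case (step k)
  then obtain t S' where S': "eval_test b S" "runs P S t S'" "t \<le> c" "I (Suc k) S'"
    using assms(3)[of k S] by (auto simp: runs_within_def)
  from step.IH[OF S'(4)] obtain u S'' where
    S'': "runs (While b P) S' u S''" "u \<le> (m - Suc k) * Suc c + 1" "I m S''"
    by (auto simp: runs_within_def)
  have "(m - k) * Suc c = (m - Suc k) * Suc c + Suc c"
    using \<open>k < m\<close> by (metis Suc_diff_Suc add.commute mult_Suc)
  then have "t + u + 1 \<le> (m - k) * Suc c + 1"
    using S'(3) S''(2) by linarith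
  with runs.WhileTrue[OF S'(1,2) S''(1)] S''(3) show ?case
    by (auto simp: runs_within_def)
qed

subsection \<open>The program\<close>

text \<open>
  Registers: \<open>2\<close> is the input position, \<open>3\<close> and \<open>4\<close> are the positions of its mirror images in the
  left and right half of the output, \<open>5\<close> is the end of the input row, \<open>6\<close> counts the additions
  that compute \<open>n * d\<close>, \<open>7\<close> holds \<open>1\<close> and \<open>8\<close> holds \<open>n * d\<close>. The left half is filled in rows from
  the last one to the first.
\<close>

definition product_loop :: prog where
  "product_loop = While (ILess 6 0) (block (IAdd 4 4 1) [IAdd 6 6 7])"

text \<open>The three rows of loads and stores serve \<open>\<mu>\<close>, \<open>\<sigma>\<close>
  and \<open>\<tau>\<close> in turn, with register \<open>0\<close> supplying the zeros.\<close>

definition copy_entry :: prog where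
  "copy_entry = block (RLoad 1 0 2) [RStore 3 3 1, RStore 3 4 0,
     RLoad 1 1 2, RStore 4 3 0, RStore 4 4 1,
     RLoad 1 2 2, RStore 5 3 1, RStore 5 4 1,
     IAdd 2 2 7, IAdd 3 3 7, IAdd 4 4 7]"

text \<open>Entries run forward but left rows run backward, so register \<open>3\<close> goes back
  by \<open>d\<close> both before and after the row.\<close>

definition copy_row :: prog where
  "copy_row = Seq (block (ISub 3 3 1) [IAdd 5 2 1])
     (Seq (While (ILess 2 5) copy_entry) (block (ISub 3 3 1) []))"

text \<open>\<open>n * d\<close> needs repeated addition because the machine does not multiply
  naturals. Adding register \<open>2\<close>, still \<open>0\<close>, moves a value; the last
  instruction doubles the number of rows.\<close>

definition reduction :: prog where
  "reduction =
     Seq (block (IConst 2 0) [IConst 4 0, IConst 6 0, IConst 7 1, RConst 0 0])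
    (Seq product_loop
    (Seq (block (IAdd 3 4 2) [IAdd 8 4 2])
    (Seq (While (ILess 2 8) copy_row)
         (block (IAdd 0 0 0) []))))"

section \<open>Addresses, loop invariants and step counts\<close>

lemma row_major_eq_iff:
  fixes d :: nat
  assumes "s < d" "s' < d"
  shows "r * d + s = r' * d + s' \<longleftrightarrow> r = r' \<and> s = s'"
proof
  assume eq: "r * d + s = r' * d + s'"
  from arg_cong[OF eq, of "\<lambda>x. x div d"] arg_cong[OF eq, of "\<lambda>x. x mod d"]
  show "r = r' \<and> s = s'" using assms by simp
qed simp

text \<open>\<open>p\<close> counts the input entries already copied; \<open>r\<close> and
  \<open>s\<close> start at \<open>0\<close>. The input arrays must stay intact for the later
  reads.\<close>

definition copied :: "nat \<Rightarrow> nat \<Rightarrow> (nat \<Rightarrow> nat \<Rightarrow> real) \<Rightarrow> nat \<Rightarrow> (nat \<Rightarrow> nat \<Rightarrow> real) \<Rightarrow> bool" where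
  "copied n d A p R \<longleftrightarrow> R 0 = A 0 \<and> R 1 = A 1 \<and> R 2 = A 2 \<and>
     (\<forall>r s. r < n \<longrightarrow> s < d \<longrightarrow> r * d + s < p \<longrightarrow>
        R 3 ((n - 1 - r) * d + s) = A 0 (r * d + s) \<and> R 3 ((n + r) * d + s) = 0 \<and>
        R 4 ((n - 1 - r) * d + s) = 0 \<and> R 4 ((n + r) * d + s) = A 1 (r * d + s) \<and>
        R 5 ((n - 1 - r) * d + s) = A 2 (r * d + s) \<and>
        R 5 ((n + r) * d + s) = A 2 (r * d + s))"

text \<open>No write destroys an earlier one: left addresses are below \<open>n * d\<close>, right
  ones are not, and within a half the address determines row and column.\<close>

lemma copied_step:
  assumes "copied n d A (r * d + s) R" and r: "r < n" and s: "s < d"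
  defines "l \<equiv> (n - 1 - r) * d + s" and "h \<equiv> (n + r) * d + s"
  shows "copied n d A (Suc (r * d + s))
    (R(3 := (R 3)(l := A 0 (r * d + s), h := 0), 4 := (R 4)(l := 0, h := A 1 (r * d + s)),
       5 := (R 5)(l := A 2 (r * d + s), h := A 2 (r * d + s))))"
proof -
  have low: "(n - 1 - r') * d + s' < n * d" if "r' < n" "s' < d" for r' s'
  proof -
    have "(n - 1 - r') * d + s' < Suc (n - 1 - r') * d" using that by simp
    also have "\<dots> \<le> n * d" using that by (intro mult_le_mono1) simp
    finally show ?thesis .
  qed
  have lh: "l < n * d" "n * d \<le> h" using low[OF r s] by (auto simp: l_def h_def algebra_simps)
  have neq: "(n - 1 - r') * d + s' \<noteq> h" "(n + r') * d + s' \<noteq> l" if "r' < n" "s' < d" for r' s'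
    using low[OF that] lh by (auto simp: algebra_simps)
  have eq: "(n - 1 - r') * d + s' = l \<longleftrightarrow> r' = r \<and> s' = s"
    "(n + r') * d + s' = h \<longleftrightarrow> r' = r \<and> s' = s"
    "r' * d + s' = r * d + s \<longleftrightarrow> r' = r \<and> s' = s" if "r' < n" "s' < d" for r' s'
    using that r s unfolding l_def h_def by (auto simp: row_major_eq_iff)
  show ?thesis
    using assms(1) neq eq unfolding copied_def
    by (auto simp: less_Suc_eq)
qed

text \<open>The right position is \<open>p\<close> shifted by \<open>n * d\<close>; the left one
  jumps between rows and is therefore a separate parameter \<open>l\<close>.\<close>

definition copy_inv :: "nat \<Rightarrow> nat \<Rightarrow> (nat \<Rightarrow> nat \<Rightarrow> real) \<Rightarrow> nat \<Rightarrow> nat \<Rightarrow> state \<Rightarrow> bool" where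
  "copy_inv n d A l p S \<longleftrightarrow> ireg S 0 = n \<and> ireg S 1 = d \<and> ireg S 2 = p \<and> ireg S 3 = l \<and>
     ireg S 4 = n * d + p \<and> ireg S 7 = 1 \<and> ireg S 8 = n * d \<and> rreg S 0 = 0 \<and>
     copied n d A p (rarr S)"

lemma copy_entry:
  assumes "copy_inv n d A ((n - 1 - r) * d + s) (r * d + s) S" "ireg S 5 = e" "r < n" "s < d"
  shows "runs_within copy_entry S 12
    (\<lambda>S. copy_inv n d A ((n - 1 - r) * d + Suc s) (r * d + Suc s) S \<and> ireg S 5 = e)"
proof -
  have copied: "copied n d A (r * d + s) (rarr S)" using assms by (simp add: copy_inv_def)
  then have "rarr S 0 = A 0" "rarr S 1 = A 1" "rarr S 2 = A 2" by (auto simp: copied_def)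
  \<comment> \<open>This identifies the address in \<open>copied\<close> with the content of
    register \<open>4\<close>.\<close>
  moreover have "(n + r) * d + s = n * d + (r * d + s)" by (simp add: add_mult_distrib)
  ultimately show ?thesis
    unfolding copy_entry_def
    using assms(1,2) copied_step[OF copied assms(3,4)]
    by (intro runs_within_block) (simp_all add: copy_inv_def add.assoc)
qed

text \<open>An entry costs \<open>12\<close> instructions and a test; the other \<open>4\<close>
  steps are three instructions and the failing test.\<close>

lemma copy_row:
  assumes "copy_inv n d A ((n - r) * d) (r * d) S" "r < n"
  shows "runs_within copy_row S (13 * d + 4)
    (copy_inv n d A ((n - Suc r) * d) (Suc r * d))"
proof -
  let ?I = "\<lambda>s S. copy_inv n d A ((n - 1 - r) * d + s) (r * d + s) S \<and> ireg S 5 = r * d + d"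
  have "(n - r) * d = (n - 1 - r) * d + d"
    using \<open>r < n\<close> by (metis Suc_diff_Suc add.commute diff_Suc_eq_diff_pred mult_Suc)
  then have start: "runs_within (block (ISub 3 3 1) [IAdd 5 2 1]) S 2 (?I 0)"
    using assms
    by (intro runs_within_block)
      (simp_all add: copy_inv_def)
  have loop: "runs_within (While (ILess 2 5) copy_entry) S' (13 * d + 1) (?I d)"
    if "?I 0 S'" for S'
  proof -
    have "runs_within (While (ILess 2 5) copy_entry) S' ((d - 0) * Suc 12 + 1) (?I d)"
      using that
    proof (intro runs_within_While[where I = ?I])
      fix s S assume "s < d" "?I s S"
      then show "eval_test (ILess 2 5) S \<and> runs_within copy_entry S 12 (?I (Suc s))"
        using copy_entry[of n d A r s S] \<open>r < n\<close> by (auto simp: copy_inv_def)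
    qed (auto simp: copy_inv_def)
    then show ?thesis by (simp add: mult.commute)
  qed
  have finish: "runs_within (block (ISub 3 3 1) []) S' 1
    (copy_inv n d A ((n - Suc r) * d) (Suc r * d))" if "?I d S'" for S'
    using that
    by (intro runs_within_block)
      (simp_all add: copy_inv_def add.commute)
  have steps: "13 * d + 4 = 2 + (13 * d + 1 + 1)" by simp
  show ?thesis
    unfolding steps copy_row_def
    by (intro runs_within_Seq[OF start] runs_within_Seq[OF loop] finish)
qed

lemma product_loop:
  assumes "ireg S 0 = n \<and> ireg S 1 = d \<and> ireg S 2 = 0 \<and> ireg S 4 = 0 \<and> ireg S 6 = 0 \<and>
    ireg S 7 = 1 \<and> rreg S 0 = 0 \<and> rarr S = A"
  shows "runs_within product_loop S (3 * n + 1)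
    (\<lambda>S. ireg S 0 = n \<and> ireg S 1 = d \<and> ireg S 2 = 0 \<and> ireg S 4 = n * d \<and>
       ireg S 7 = 1 \<and> rreg S 0 = 0 \<and> rarr S = A)"
proof -
  let ?I = "\<lambda>k (S :: state). ireg S 0 = n \<and> ireg S 1 = d \<and> ireg S 2 = 0 \<and> ireg S 4 = k * d \<and>
    ireg S 6 = k \<and> ireg S 7 = 1 \<and> rreg S 0 = 0 \<and> rarr S = A"
  have "runs_within product_loop S ((n - 0) * Suc 2 + 1) (?I n)"
    unfolding product_loop_def
  proof (intro runs_within_While[where I = ?I])
    fix k and S :: state assume "k < n" "?I k S"
    then show "eval_test (ILess 6 0) S \<and>
      runs_within (block (IAdd 4 4 1) [IAdd 6 6 7]) S 2 (?I (Suc k))"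
      by (intro conjI runs_within_block)
        simp_all
  qed (use assms in auto)
  then show ?thesis by (auto simp: runs_within_def mult.commute)
qed

lemma reduction:
  assumes "ireg S 0 = n" "ireg S 1 = d" "d \<ge> 1"
  shows "runs_within reduction S (13 * (n * d) + 8 * n + 10)
    (\<lambda>S'. ireg S' 0 = 2 * n \<and> ireg S' 1 = d \<and> copied n d (rarr S) (n * d) (rarr S'))"
proof -
  let ?A = "rarr S"
  let ?I = "\<lambda>r. copy_inv n d ?A ((n - r) * d) (r * d)"
  have init: "runs_within
      (block (IConst 2 0) [IConst 4 0, IConst 6 0, IConst 7 1, RConst 0 0]) S 5
    (\<lambda>S. ireg S 0 = n \<and> ireg S 1 = d \<and> ireg S 2 = 0 \<and> ireg S 4 = 0 \<and> ireg S 6 = 0 \<and>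
      ireg S 7 = 1 \<and> rreg S 0 = 0 \<and> rarr S = ?A)"
    using assms
    by (intro runs_within_block) simp_all
  have start: "runs_within (block (IAdd 3 4 2) [IAdd 8 4 2]) S' 2 (?I 0)"
    if "ireg S' 0 = n \<and> ireg S' 1 = d \<and> ireg S' 2 = 0 \<and> ireg S' 4 = n * d \<and>
      ireg S' 7 = 1 \<and> rreg S' 0 = 0 \<and> rarr S' = ?A" for S'
    using that
    by (intro runs_within_block)
      (simp_all add: copy_inv_def copied_def)
  have loop: "runs_within (While (ILess 2 8) copy_row) S' ((n - 0) * Suc (13 * d + 4) + 1) (?I n)"
    if "?I 0 S'" for S'
    using that
  proof (intro runs_within_While[where I = ?I])
    \<comment> \<open>As \<open>d \<ge> 1\<close>, \<open>r < n\<close> gives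
      \<open>r * d < n * d\<close>, which is what the test compares.\<close>
    fix r S' assume "r < n" "?I r S'"
    then show "eval_test (ILess 2 8) S' \<and> runs_within copy_row S' (13 * d + 4) (?I (Suc r))"
      using copy_row[of n d ?A r S'] \<open>d \<ge> 1\<close> by (auto simp: copy_inv_def)
  qed (auto simp: copy_inv_def)
  have finish: "runs_within (block (IAdd 0 0 0) []) S' 1
    (\<lambda>S'. ireg S' 0 = 2 * n \<and> ireg S' 1 = d \<and> copied n d ?A (n * d) (rarr S'))"
    if "?I n S'" for S'
    using that
    by (intro runs_within_block)
      (simp_all add: copy_inv_def)
  have "runs_within reduction S
      (5 + (3 * n + 1 + (2 + ((n - 0) * Suc (13 * d + 4) + 1 + 1))))
      (\<lambda>S'. ireg S' 0 = 2 * n \<and> ireg S' 1 = d \<and> copied n d ?A (n * d) (rarr S'))"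
    unfolding reduction_def
    by (intro runs_within_Seq[OF init] runs_within_Seq[OF product_loop]
        runs_within_Seq[OF start] runs_within_Seq[OF loop] finish)
  then show ?thesis by (simp add: algebra_simps)
qed

section \<open>The final memory as an instance\<close>

lemma stores_vectors_row_major:
  assumes "stores_vectors a m d v S" "r < m" "s < d"
  shows "rarr S a (r * d + s) = v (Suc r) (Suc s)"
proof -
  have "Suc r \<in> {1..m}" "Suc s \<in> {1..d}" using assms(2,3) by auto
  with assms(1) show ?thesis unfolding stores_vectors_def by fastforce
qed

lemma stores_instance_copied:
  assumes inst: "stores_instance 0 n d \<mu> \<sigma> \<tau> S"
    and S': "ireg S' 0 = 2 * n" "ireg S' 1 = d" "copied n d (rarr S) (n * d) (rarr S')"
  shows "stores_instance 3 (2 * n) d (left_vectors n \<mu>) (right_vectors n \<sigma>)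
    (\<lambda>k. \<tau> (mirror n k)) S'"
proof -
  have input: "rarr S 0 (r * d + s) = \<mu> (Suc r) (Suc s)" "rarr S 1 (r * d + s) = \<sigma> (Suc r) (Suc s)"
    "rarr S 2 (r * d + s) = \<tau> (Suc r) (Suc s)" if "r < n" "s < d" for r s
    using inst that stores_vectors_row_major[of _ n d _ S r s]
    by (auto simp: stores_instance_def numeral_2_eq_2)
  have *: "rarr S' 3 ((i - 1) * d + (s - 1)) = left_vectors n \<mu> i s \<and>
    rarr S' 4 ((i - 1) * d + (s - 1)) = right_vectors n \<sigma> i s \<and>
    rarr S' 5 ((i - 1) * d + (s - 1)) = \<tau> (mirror n i) s"
    if i: "i \<in> {1..2 * n}" and s: "s \<in> {1..d}" for i s
  proof -
    \<comment> \<open>Output row \<open>i\<close> was written while input row \<open>r\<close>,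
      counted from \<open>0\<close>, was copied.\<close>
    define r where "r = mirror n i - 1"
    have r: "r < n" and s': "s - 1 < d" "Suc (s - 1) = s" "Suc r = mirror n i"
      using i s by (auto simp: r_def mirror_def)
    have "r * d + (s - 1) < Suc r * d" using s'(1) by simp
    also have "\<dots> \<le> n * d" using r by (intro mult_le_mono1) simp
    finally have "r * d + (s - 1) < n * d" .
    note out = S'(3)[unfolded copied_def, THEN conjunct2, THEN conjunct2, THEN conjunct2,
        rule_format, OF r s'(1) this]
    show ?thesis
    proof (cases "i \<le> n")
      case True
      then have "n - 1 - r = i - 1" "mirror n i = n + 1 - i"
        using i by (auto simp: r_def mirror_def)
      with True out input[OF r s'(1)] s' show ?thesis
        by (simp add: left_vectors_def right_vectors_def)
    next
      case False
      then have "n + r = i - 1" "mirror n i = i - n"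
        using i by (auto simp: r_def mirror_def)
      with False out input[OF r s'(1)] s' show ?thesis
        by (simp add: left_vectors_def right_vectors_def)
    qed
  qed
  then show ?thesis
    using S'(1,2) by (simp add: stores_instance_def stores_vectors_def)
qed

theorem theorem4p1:
  "\<exists>(P :: prog) (C :: nat).
     \<forall>(n :: nat) (d :: nat) (\<mu> :: nat \<Rightarrow> nat \<Rightarrow> real) (\<sigma> :: nat \<Rightarrow> nat \<Rightarrow> real)
       (\<tau> :: nat \<Rightarrow> nat \<Rightarrow> real) (w :: nat \<Rightarrow> nat \<Rightarrow> nat \<Rightarrow> int) (S :: state).
       n \<ge> 1 \<longrightarrow> d \<ge> 1 \<longrightarrow>
       defines_tensor n d \<mu> \<sigma> \<tau> w \<longrightarrow>
       stores_instance 0 n d \<mu> \<sigma> \<tau> S \<longrightarrow>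
       (\<exists>t S' \<mu>' \<sigma>' \<tau>' (w' :: nat \<Rightarrow> nat \<Rightarrow> nat \<Rightarrow> int).
          runs P S t S' \<and> t \<le> C * (n * d) \<and>
          stores_instance 3 (2 * n) d \<mu>' \<sigma>' \<tau>' S' \<and>
          defines_tensor (2 * n) d \<mu>' \<sigma>' \<tau>' w' \<and>
          lws2_pt (2 * n) (\<lambda>i j k. ereal (real_of_int (w' i j k))) =
          lws2 n (\<lambda>i j k. ereal (real_of_int (w i j k))) (\<lambda>i j k. ereal (real_of_int (w i j k))))"
proof (rule exI[of _ reduction], rule exI[of _ 31], intro allI impI)
  fix n d \<mu> \<sigma> \<tau> w S
  assume n: "n \<ge> 1" and d: "d \<ge> 1" and w: "defines_tensor n d \<mu> \<sigma> \<tau> w"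
    and S: "stores_instance 0 n d \<mu> \<sigma> \<tau> S"
  from S have "ireg S 0 = n" "ireg S 1 = d" by (auto simp: stores_instance_def)
  from reduction[OF this d] obtain t S' where
    t: "runs reduction S t S'" "t \<le> 13 * (n * d) + 8 * n + 10"
    and S': "ireg S' 0 = 2 * n" "ireg S' 1 = d" "copied n d (rarr S) (n * d) (rarr S')"
    by (auto simp: runs_within_def)
  \<comment> \<open>With these, \<open>13 * (n * d) + 8 * n + 10\<close> is at most
    \<open>13 + 8 + 10 = 31\<close> times \<open>n * d\<close>.\<close>
  have "n \<le> n * d" "1 \<le> n * d" using n d by auto
  with t(2) have "t \<le> 31 * (n * d)" by linarith
  with t(1) stores_instance_copied[OF S S'] defines_tensor_fold[OF w] lws2_pt_fold[OF n]
  show "\<exists>t S' \<mu>' \<sigma>' \<tau>' w'.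
      runs reduction S t S' \<and> t \<le> 31 * (n * d) \<and>
      stores_instance 3 (2 * n) d \<mu>' \<sigma>' \<tau>' S' \<and>
      defines_tensor (2 * n) d \<mu>' \<sigma>' \<tau>' w' \<and>
      lws2_pt (2 * n) (\<lambda>i j k. ereal (real_of_int (w' i j k))) =
      lws2 n (\<lambda>i j k. ereal (real_of_int (w i j k))) (\<lambda>i j k. ereal (real_of_int (w i j k)))"
    by blast
qed

end
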